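(* Let $(V,\omega)$ be a symplectic real vector space of dimension $2n$ with a fixed basis, and let $X:V\to V$ be an $\omega$-Hamiltonian vector field. Then $dX_x\in\mathfrak{sp}_{\omega}(n;\mathbb{R})$ for all $x\in V$.
   Context: A symplectic vector space $(V,\omega)$ is a finite-dimensional real vector space $V$ (of even dimension $2n$) with an alternating non-degenerate bilinear form $\omega:V\times V\to\mathbb{R}$. A (not necessarily symplectic) basis of $V$ is fixed, vectors are identified with their coordinate columns, and $[\omega]\in\mathbb{M}_{2n}(\mathbb{R})$ is the (skew-symmetric, invertible) matrix of $\omega$ in this basis, so $\omega(\mathbf u,\mathbf v)=\mathbf u^T[\omega]\mathbf v$. A vector field $X:V\to V$ is $\omega$-Hamiltonian if there is a smooth function $H:V\to\mathbb{R}$ such that $\omega(X(x),\cdot)=dH_x$ for all $x\in V$; equivalently $X(x)=([\omega]^{-1})^T\nabla H(x)$, where $\nabla H$ is the column of partial derivatives of $H$ in the fixed basis. $\mathfrak{sp}_{\omega}(n;\mathbb{R})=\{L\in\mathbb{M}_{2n}(\mathbb{R}): L^T[\omega]+[\omega]L=0\}$. The symbol $dX_x$ denotes the matrix, in the fixed basis, of the derivative of $X$ at $x$. *)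

theory Defs
  imports "HOL-Analysis.Analysis"
begin

text \<open>
  The symplectic space is a type of class \<open>euclidean_space\<close>; its inner product serves only to
  provide the usual topology of a finite-dimensional real vector space and is unrelated to the
  symplectic form and to the fixed basis.
\<close>

definition symplectic_form :: "('v::euclidean_space \<Rightarrow> 'v \<Rightarrow> real) \<Rightarrow> bool" where
  "symplectic_form \<omega> \<longleftrightarrow>
     bilinear \<omega> \<and> (\<forall>u. \<omega> u u = 0) \<and> (\<forall>u. (\<forall>v. \<omega> u v = 0) \<longrightarrow> u = 0)"

definition basis_family :: "('m::finite \<Rightarrow> 'v::euclidean_space) \<Rightarrow> bool" where
  "basis_family b \<longleftrightarrow> inj b \<and> independent (range b) \<and> span (range b) = UNIV"

definition form_matrix ::
    "('m::finite \<Rightarrow> 'v::euclidean_space) \<Rightarrow> ('v \<Rightarrow> 'v \<Rightarrow> real) \<Rightarrow> real ^ 'm ^ 'm" where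
  "form_matrix b \<omega> = (\<chi> i j. \<omega> (b i) (b j))"

text \<open>Column \<open>j\<close> consists of the \<open>b\<close>-coordinates of \<open>f (b j)\<close>.\<close>

definition matrix_in_basis ::
    "('m::finite \<Rightarrow> 'v::euclidean_space) \<Rightarrow> ('v \<Rightarrow> 'v) \<Rightarrow> real ^ 'm ^ 'm" where
  "matrix_in_basis b f = (\<chi> i j. representation (range b) (f (b j)) (b i))"

text \<open>
  In finite dimension, a differentiable \<open>f\<close> is of class C^(k+1) iff each of its
  directional derivatives is of class C^k; this recursion avoids the spaces of
  multilinear maps in which the iterated derivatives live.
\<close>

primrec C_k :: "nat \<Rightarrow> ('v::euclidean_space \<Rightarrow> real) \<Rightarrow> bool" where
  "C_k 0 f \<longleftrightarrow> continuous_on UNIV f"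
| "C_k (Suc k) f \<longleftrightarrow>
     (\<forall>x. f differentiable (at x)) \<and> (\<forall>v. C_k k (\<lambda>x. frechet_derivative f (at x) v))"

definition smooth :: "('v::euclidean_space \<Rightarrow> real) \<Rightarrow> bool" where
  "smooth f \<longleftrightarrow> (\<forall>k. C_k k f)"

definition hamiltonian_vector_field ::
    "('v::euclidean_space \<Rightarrow> 'v \<Rightarrow> real) \<Rightarrow> ('v \<Rightarrow> 'v) \<Rightarrow> bool" where
  "hamiltonian_vector_field \<omega> X \<longleftrightarrow>
     (\<exists>H. smooth H \<and> (\<forall>x. \<omega> (X x) = frechet_derivative H (at x)))"

text \<open>The argument \<open>W\<close> is the matrix of the symplectic form in the fixed basis.\<close>

definition sp_algebra :: "real ^ 'm ^ 'm \<Rightarrow> (real ^ 'm ^ 'm) set" where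
  "sp_algebra W = {L. transpose L ** W + W ** L = 0}"

end

theory Submission
  imports Defs
begin

text \<open>
  Differentiating \<open>\<omega> (X x) v = dH\<^sub>x v\<close> in the direction \<open>u\<close> gives
  \<open>\<omega> (dX\<^sub>x u) v = D\<^sub>u D\<^sub>v H x\<close>. The right-hand side is symmetric in \<open>u\<close> and \<open>v\<close> by Schwarz's
  theorem, so with the antisymmetry of \<open>\<omega>\<close> we get \<open>\<omega> (dX\<^sub>x u) v + \<omega> u (dX\<^sub>x v) = 0\<close>, which on
  basis vectors is the matrix identity.
\<close>

lemma C_k_2D:
  assumes "C_k 2 H"
  shows "H differentiable (at x)"
    and "(\<lambda>y. frechet_derivative H (at y) v) differentiable (at x)"
    and "continuous_on UNIV
      (\<lambda>y. frechet_derivative (\<lambda>z. frechet_derivative H (at z) v) (at y) u)"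
  using assms by (auto simp: numeral_2_eq_2)

text \<open>Reduces directional derivatives on the space to one-variable derivatives, so that the
  mean value theorem on the real line applies.\<close>

lemma has_real_derivative_along_line:
  fixes f :: "'v::real_normed_vector \<Rightarrow> real"
  assumes "f differentiable (at (p + t *\<^sub>R u))"
  shows "((\<lambda>s. f (p + s *\<^sub>R u)) has_real_derivative
           frechet_derivative f (at (p + t *\<^sub>R u)) u) (at t)"
proof -
  let ?D = "frechet_derivative f (at (p + t *\<^sub>R u))"
  have D: "(f has_derivative ?D) (at (p + t *\<^sub>R u))"
    using assms frechet_derivative_works by blast
  have "((\<lambda>s. p + s *\<^sub>R u) has_derivative (\<lambda>s. s *\<^sub>R u)) (at t)"
    by (auto intro!: derivative_eq_intros)
  from has_derivative_compose[OF this D]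
  have "((\<lambda>s. f (p + s *\<^sub>R u)) has_derivative (\<lambda>s. ?D (s *\<^sub>R u))) (at t)" .
  moreover have "?D (s *\<^sub>R u) = ?D u * s" for s
    using linear_scale[OF has_derivative_linear[OF D]] by simp
  ultimately show ?thesis
    by (simp add: has_field_derivative_def)
qed

text \<open>Two uses of the one-variable mean value theorem: along \<open>u\<close> for an increment
  of \<open>H\<close>, then along \<open>v\<close> for the resulting increment of the derivative in
  direction \<open>u\<close>. This order decides which of the two mixed derivatives appears.\<close>

lemma second_difference_mvt:
  fixes H :: "'v::euclidean_space \<Rightarrow> real"
  assumes "C_k 2 H" and "0 < h"
  obtains s t where "0 < s" "s < h" "0 < t" "t < h"
    and "H (x + h *\<^sub>R u + h *\<^sub>R v) - H (x + h *\<^sub>R u) - H (x + h *\<^sub>R v) + H x =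
      h\<^sup>2 * frechet_derivative (\<lambda>z. frechet_derivative H (at z) u) (at (x + s *\<^sub>R u + t *\<^sub>R v)) v"
proof -
  let ?D = "\<lambda>z. frechet_derivative H (at z) u"
  \<comment> \<open>\<open>g s\<close> is the increment of \<open>H\<close> over
    \<open>h *\<^sub>R v\<close> from the base point \<open>x + s *\<^sub>R u\<close>, so
    \<open>g h - g 0\<close> is the second difference.\<close>
  define g where "g s = H ((x + h *\<^sub>R v) + s *\<^sub>R u) - H (x + s *\<^sub>R u)" for s
  have g: "(g has_real_derivative (?D ((x + h *\<^sub>R v) + s *\<^sub>R u) - ?D (x + s *\<^sub>R u))) (at s)" for s
    unfolding g_def
    by (intro DERIV_diff has_real_derivative_along_line C_k_2D(1)[OF assms(1)])
  obtain s where s: "0 < s" "s < h"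
    "g h - g 0 = (h - 0) * (?D ((x + h *\<^sub>R v) + s *\<^sub>R u) - ?D (x + s *\<^sub>R u))"
    using MVT2[OF \<open>0 < h\<close> g] by blast
  have k: "((\<lambda>t. ?D ((x + s *\<^sub>R u) + t *\<^sub>R v)) has_real_derivative
      frechet_derivative ?D (at ((x + s *\<^sub>R u) + t *\<^sub>R v)) v) (at t)" for t
    by (intro has_real_derivative_along_line C_k_2D(2)[OF assms(1)])
  obtain t where t: "0 < t" "t < h"
    "?D ((x + s *\<^sub>R u) + h *\<^sub>R v) - ?D ((x + s *\<^sub>R u) + 0 *\<^sub>R v) =
      (h - 0) * frechet_derivative ?D (at ((x + s *\<^sub>R u) + t *\<^sub>R v)) v"
    using MVT2[OF \<open>0 < h\<close> k] by blast
  show thesis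
  proof (rule that[OF s(1,2) t(1,2)])
    show "H (x + h *\<^sub>R u + h *\<^sub>R v) - H (x + h *\<^sub>R u) - H (x + h *\<^sub>R v) + H x =
      h\<^sup>2 * frechet_derivative ?D (at (x + s *\<^sub>R u + t *\<^sub>R v)) v"
      using s(3) t(3) by (simp add: g_def power2_eq_square add_ac)
  qed
qed

text \<open>The intermediate point given by the mean value theorem is forced to \<open>x\<close> as
  \<open>h\<close> shrinks, and the mixed derivative is continuous. The limit is from the right
  because the mean value step takes \<open>0 < h\<close>.\<close>

lemma second_difference_tendsto:
  fixes H :: "'v::euclidean_space \<Rightarrow> real"
  assumes "C_k 2 H"
  shows "((\<lambda>h. (H (x + h *\<^sub>R u + h *\<^sub>R v) - H (x + h *\<^sub>R u) - H (x + h *\<^sub>R v) + H x) / h\<^sup>2)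
      \<longlongrightarrow> frechet_derivative (\<lambda>z. frechet_derivative H (at z) u) (at x) v) (at_right 0)"
proof (rule tendstoI)
  let ?F = "\<lambda>y. frechet_derivative (\<lambda>z. frechet_derivative H (at z) u) (at y) v"
  fix e :: real assume "0 < e"
  then obtain d where d: "0 < d" "\<And>y. dist y x < d \<Longrightarrow> dist (?F y) (?F x) < e"
    using C_k_2D(3)[OF assms, of u v] unfolding continuous_on_iff by blast
  \<comment> \<open>Chosen so that \<open>h < c\<close> puts the intermediate point within
    \<open>d\<close> of \<open>x\<close>. The summand 1 keeps the denominator positive even for
    \<open>u = v = 0\<close>.\<close>
  define c where "c = d / (norm u + norm v + 1)"
  have N: "0 < norm u + norm v + 1"
    by (simp add: add_nonneg_pos)
  have "0 < c"
    using d(1) N by (simp add: c_def)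
  show "\<forall>\<^sub>F h in at_right 0. dist
      ((H (x + h *\<^sub>R u + h *\<^sub>R v) - H (x + h *\<^sub>R u) - H (x + h *\<^sub>R v) + H x) / h\<^sup>2) (?F x) < e"
    unfolding eventually_at_right_field
  proof (intro exI[of _ c] conjI allI impI)
    fix h :: real assume h: "0 < h" "h < c"
    obtain s t where st: "0 < s" "s < h" "0 < t" "t < h"
      and eq: "H (x + h *\<^sub>R u + h *\<^sub>R v) - H (x + h *\<^sub>R u) - H (x + h *\<^sub>R v) + H x =
        h\<^sup>2 * ?F (x + s *\<^sub>R u + t *\<^sub>R v)"
      using second_difference_mvt[OF assms h(1)] by blast
    have "dist (x + s *\<^sub>R u + t *\<^sub>R v) x = norm (s *\<^sub>R u + t *\<^sub>R v)"
      by (simp add: dist_norm)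
    also have "\<dots> \<le> s * norm u + t * norm v"
      using norm_triangle_ineq[of "s *\<^sub>R u" "t *\<^sub>R v"] st by simp
    also have "\<dots> \<le> h * norm u + h * norm v"
      using st by (intro add_mono mult_right_mono) auto
    also have "\<dots> < h * (norm u + norm v + 1)"
      using h by (simp add: algebra_simps)
    also have "\<dots> < d"
      using h(2) N by (simp add: c_def pos_less_divide_eq)
    finally have "dist (?F (x + s *\<^sub>R u + t *\<^sub>R v)) (?F x) < e"
      by (rule d(2))
    then show "dist ((H (x + h *\<^sub>R u + h *\<^sub>R v) - H (x + h *\<^sub>R u) - H (x + h *\<^sub>R v) + H x) / h\<^sup>2)
        (?F x) < e"
      using h(1) by (simp add: eq)
  qed (fact \<open>0 < c\<close>)
qed

text \<open>The second difference is unchanged when \<open>u\<close> and \<open>v\<close> are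
  exchanged, so both mixed derivatives are limits of the same quotient.\<close>

lemma schwarz_symmetry:
  fixes H :: "'v::euclidean_space \<Rightarrow> real"
  assumes "C_k 2 H"
  shows "frechet_derivative (\<lambda>z. frechet_derivative H (at z) u) (at x) v =
         frechet_derivative (\<lambda>z. frechet_derivative H (at z) v) (at x) u"
proof (rule tendsto_unique)
  show "((\<lambda>h. (H (x + h *\<^sub>R u + h *\<^sub>R v) - H (x + h *\<^sub>R u) - H (x + h *\<^sub>R v) + H x) / h\<^sup>2)
      \<longlongrightarrow> frechet_derivative (\<lambda>z. frechet_derivative H (at z) v) (at x) u) (at_right 0)"
    using second_difference_tendsto[OF assms, of x v u] by (simp add: add_ac diff_diff_eq)
\<comment> \<open>What remains is that \<open>at_right 0\<close> is a nontrivial filter, and the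
  limit with \<open>u\<close> and \<open>v\<close> in their original order.\<close>
qed (simp, rule second_difference_tendsto[OF assms])

lemma symplectic_form_skew:
  assumes "symplectic_form \<omega>"
  shows "\<omega> u v = - \<omega> v u"
proof -
  have bil: "bilinear \<omega>" and alt: "\<omega> w w = 0" for w
    using assms by (auto simp: symplectic_form_def)
  have "0 = \<omega> (u + v) (u + v)"
    by (simp add: alt)
  also have "\<dots> = \<omega> u v + \<omega> v u"
    by (simp add: bilinear_ladd[OF bil] bilinear_radd[OF bil] alt[of u] alt[of v])
  finally show ?thesis
    by linarith
qed

text \<open>By nondegeneracy, \<open>X\<close> is recovered from finitely many of the functions
  \<open>\<omega> (X y) v\<close> by a linear map, which preserves differentiability.\<close>

lemma nondegenerate_differentiable:
  fixes \<omega> :: "'v::euclidean_space \<Rightarrow> 'v \<Rightarrow> real"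
    and X :: "'a::real_normed_vector \<Rightarrow> 'v"
  assumes "symplectic_form \<omega>" and "\<And>v. (\<lambda>y. \<omega> (X y) v) differentiable (at x)"
  shows "X differentiable (at x)"
proof -
  have bil: "bilinear \<omega>" and nondeg: "\<And>u. (\<And>v. \<omega> u v = 0) \<Longrightarrow> u = 0"
    using assms(1) by (auto simp: symplectic_form_def)
  \<comment> \<open>\<open>J u\<close> is the vector that represents the functional
    \<open>\<omega> u\<close> through the inner product; its coordinates are values of
    \<open>\<omega> u\<close> on \<open>Basis\<close>.\<close>
  define J where "J u = (\<Sum>i\<in>Basis. \<omega> u i *\<^sub>R i)" for u
  have "linear J"
    by (rule linearI)
      (simp_all add: J_def bilinear_ladd[OF bil] bilinear_lmul[OF bil] scaleR_add_left
        sum.distrib scaleR_sum_right)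
  moreover have "inj J"
    unfolding linear_injective_0[OF \<open>linear J\<close>]
  proof (intro allI impI nondeg)
    fix u v assume "J u = 0"
    have "\<omega> u i = 0" if "i \<in> Basis" for i
      using arg_cong[OF \<open>J u = 0\<close>, of "\<lambda>w. w \<bullet> i"] that by (simp add: J_def)
    moreover have "linear (\<omega> u)"
      using bil by (simp add: bilinear_def)
    ultimately show "\<omega> u v = 0"
      using linear_eq_on_span[of "\<omega> u" "\<lambda>_. 0" Basis v] by (simp add: linear_zero)
  qed
  ultimately obtain K where K: "linear K" "K \<circ> J = id"
    using linear_injective_left_inverse by blast
  have "(\<lambda>y. J (X y)) differentiable (at x)"
    unfolding J_def
  proof (intro differentiable_sum ballI)
    fix i :: 'v
    show "(\<lambda>y. \<omega> (X y) i *\<^sub>R i) differentiable (at x)"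
      by (intro differentiable_compose[OF bounded_linear_imp_differentiable[OF
            bounded_linear_scaleR_left] assms(2)])
  qed simp
  then have "(\<lambda>y. K (J (X y))) differentiable (at x)"
    using K(1) linear_imp_differentiable differentiable_compose by blast
  moreover have "(\<lambda>y. K (J (X y))) = X"
    using K(2) by (simp add: fun_eq_iff)
  ultimately show ?thesis
    by simp
qed

lemma sum_matrix_in_basis:
  fixes b :: "'m::finite \<Rightarrow> 'v::euclidean_space"
  assumes "basis_family b"
  shows "(\<Sum>i\<in>UNIV. (matrix_in_basis b f $ i $ j) *\<^sub>R b i) = f (b j)"
proof -
  have b: "inj b" "independent (range b)" "span (range b) = UNIV"
    using assms by (auto simp: basis_family_def)
  \<comment> \<open>\<open>representation\<close> is indexed by the vectors of
    \<open>range b\<close>; injectivity of \<open>b\<close> turns the sum over indices into one over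
    vectors.\<close>
  have "(\<Sum>i\<in>UNIV. (matrix_in_basis b f $ i $ j) *\<^sub>R b i) =
      (\<Sum>w\<in>range b. representation (range b) (f (b j)) w *\<^sub>R w)"
    by (simp add: sum.reindex[OF b(1)] matrix_in_basis_def)
  also have "\<dots> = f (b j)"
    using b by (intro real_vector.sum_representation_eq) auto
  finally show ?thesis .
qed

text \<open>Expanding \<open>f (b i)\<close> and \<open>f (b j)\<close> in the basis shows that the
  \<open>i\<close>, \<open>j\<close> entry of the matrix sum is the hypothesis at
  \<open>u = b i\<close>, \<open>v = b j\<close>.\<close>

lemma matrix_in_basis_sp_algebra:
  fixes b :: "'m::finite \<Rightarrow> 'v::euclidean_space"
  assumes "basis_family b" and bil: "bilinear \<omega>"
    and "\<And>u v. \<omega> (f u) v + \<omega> u (f v) = 0"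
  shows "matrix_in_basis b f \<in> sp_algebra (form_matrix b \<omega>)"
proof -
  let ?L = "matrix_in_basis b f" and ?W = "form_matrix b \<omega>"
  have lin: "linear (\<lambda>u. \<omega> u v)" "linear (\<omega> u)" for u v
    using bil by (auto simp: bilinear_def)
  have "(transpose ?L ** ?W + ?W ** ?L) $ i $ j = 0" for i j
  proof -
    have "(transpose ?L ** ?W) $ i $ j = \<omega> (\<Sum>k\<in>UNIV. (?L $ k $ i) *\<^sub>R b k) (b j)"
      by (simp add: matrix_matrix_mult_def transpose_def form_matrix_def
          linear_sum[OF lin(1)] linear_scale[OF lin(1)])
    moreover have "(?W ** ?L) $ i $ j = \<omega> (b i) (\<Sum>k\<in>UNIV. (?L $ k $ j) *\<^sub>R b k)"
      by (simp add: matrix_matrix_mult_def form_matrix_def mult.commute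
          linear_sum[OF lin(2)] linear_scale[OF lin(2)])
    ultimately show ?thesis
      by (simp add: sum_matrix_in_basis[OF assms(1)] assms(3))
  qed
  then show ?thesis
    by (simp add: sp_algebra_def vec_eq_iff)
qed

theorem proposition4p4:
  fixes \<omega> :: "'v::euclidean_space \<Rightarrow> 'v \<Rightarrow> real"
    and b :: "'m::finite \<Rightarrow> 'v"
    and X :: "'v \<Rightarrow> 'v"
    and n :: nat
  assumes "DIM('v) = 2 * n"
    and "symplectic_form \<omega>"
    and "basis_family b"
    and "hamiltonian_vector_field \<omega> X"
  shows "\<forall>x. X differentiable (at x) \<and>
             matrix_in_basis b (frechet_derivative X (at x)) \<in> sp_algebra (form_matrix b \<omega>)"
proof
  fix x
  obtain H where "smooth H" and XH: "\<And>y v. \<omega> (X y) v = frechet_derivative H (at y) v"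
    using assms(4) by (auto simp: hamiltonian_vector_field_def)
  then have H: "C_k 2 H"
    by (simp add: smooth_def)
  have bil: "bilinear \<omega>"
    using assms(2) by (simp add: symplectic_form_def)
  \<comment> \<open>The pairings of \<open>X\<close> with fixed vectors are first directional
    derivatives of \<open>H\<close>, which are differentiable since \<open>H\<close> is twice
    continuously differentiable.\<close>
  have X: "X differentiable (at x)"
    by (intro nondegenerate_differentiable[OF assms(2)])
      (simp add: XH C_k_2D(2)[OF H])
  let ?D = "frechet_derivative X (at x)"
  have D: "\<omega> (?D u) v = frechet_derivative (\<lambda>y. frechet_derivative H (at y) v) (at x) u" for u v
  proof -
    have "bounded_linear (\<lambda>w. \<omega> w v)"
      using bil by (simp add: bilinear_def linear_conv_bounded_linear)
    then have "((\<lambda>y. \<omega> (X y) v) has_derivative (\<lambda>u. \<omega> (?D u) v)) (at x)"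
      using X frechet_derivative_works bounded_linear.has_derivative by blast
    then show ?thesis
      by (simp add: XH frechet_derivative_at[symmetric])
  qed
  \<comment> \<open>Skewness rewrites the second summand as \<open>- \<omega> (?D v) u\<close>; by
    \<open>D\<close> the two summands are then opposite mixed derivatives of
    \<open>H\<close>.\<close>
  have "\<omega> (?D u) v + \<omega> u (?D v) = 0" for u v
    using schwarz_symmetry[OF H, of v x u] symplectic_form_skew[OF assms(2), of u "?D v"]
    by (simp add: D)
  then show "X differentiable (at x) \<and> matrix_in_basis b ?D \<in> sp_algebra (form_matrix b \<omega>)"
    using X matrix_in_basis_sp_algebra[OF assms(3) bil] by blast
qed

end
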